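(* For each closed $\mathrm{ACP}^{\tau}_{\mathrm{drt}}$ term $t$ there exists a basic term $t'$ such that the equation $t=t'$ is derivable (in equational logic) from the axioms of $\mathrm{ACP}^{\tau}_{\mathrm{drt}}$.
   Context: Fix a finite set $A$ of basic actions with $\tau,\delta\notin A$, and a commutative and associative function $\gamma:(A\cup\{\tau,\delta\})\times(A\cup\{\tau,\delta\})\to A\cup\{\tau,\delta\}$ with $\gamma(\tau,a)=\gamma(\delta,a)=\delta$ for all $a$. The signature of $\mathrm{ACP}^{\tau}_{\mathrm{drt}}$ consists of the constants $\underline{a}$ ($a\in A$), $\underline{\tau}$, $\underline{\delta}$; the binary operators $+$, $\cdot$, $\parallel$ (parallel composition), $\lfloor\!\lfloor$ (left merge), $\mid$ (communication merge); and the unary operators $\sigma$ (one-time-slice delay), $\partial_H$ for each $H\subseteq A$, $\tau_I$ for each $I\subseteq A$, and $\nu$ (current-time-slice time-out). In terms, $\cdot$ binds strongest and $+$ weakest. The axioms of $\mathrm{ACP}^{\tau}_{\mathrm{drt}}$ are the following equations, where $a,b,c$ range over $A\cup\{\tau,\delta\}$ and $H,I\subseteq A$: $x+y=y+x$; $(x+y)+z=x+(y+z)$; $x+x=x$; $(x+y)\cdot z=x\cdot z+y\cdot z$; $(x\cdot y)\cdot z=x\cdot(y\cdot z)$; $x+\underline{\delta}=x$; $\underline{\delta}\cdot x=\underline{\delta}$; $\sigma(x)+\sigma(y)=\sigma(x+y)$; $\sigma(x)\cdot y=\sigma(x\cdot y)$; $\partial_H(\underline a)=\underline a$ if $a\notin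 H$; $\partial_H(\underline a)=\underline\delta$ if $a\in H$; $\partial_H(x+y)=\partial_H(x)+\partial_H(y)$; $\partial_H(x\cdot y)=\partial_H(x)\cdot\partial_H(y)$; $\partial_H(\sigma(x))=\sigma(\partial_H(x))$; $\tau_I(\underline a)=\underline a$ if $a\notin I$; $\tau_I(\underline a)=\underline\tau$ if $a\in I$; $\tau_I(x+y)=\tau_I(x)+\tau_I(y)$; $\tau_I(x\cdot y)=\tau_I(x)\cdot\tau_I(y)$; $\tau_I(\sigma(x))=\sigma(\tau_I(x))$; $x\parallel y=(x\lfloor\!\lfloor y+y\lfloor\!\lfloor x)+x\mid y$; $\underline a\lfloor\!\lfloor x=\underline a\cdot x$; $\underline a\cdot x\lfloor\!\lfloor y=\underline a\cdot(x\parallel y)$; $\sigma(x)\lfloor\!\lfloor\nu(y)=\underline\delta$; $\sigma(x)\lfloor\!\lfloor(\nu(y)+\sigma(z))=\sigma(x\lfloor\!\lfloor z)$; $(x+y)\lfloor\!\lfloor z=x\lfloor\!\lfloor z+y\lfloor\!\lfloor z$; $\underline a\cdot x\mid\underline b=(\underline a\mid\underline b)\cdot x$; $\underline a\mid\underline b\cdot x=(\underline a\mid\underline b)\cdot x$; $\underline a\cdot x\mid\underline b\cdot y=(\underline a\mid\underline b)\cdot(x\parallel y)$; $\nu(x)\mid\sigma(y)=\underline\delta$; $\sigma(x)\mid\nu(y)=\underline\delta$; $\sigma(x)\mid\sigma(y)=\sigma(x\mid y)$; $(x+y)\mid z=x\mid z+y\mid z$; $x\mid(y+z)=x\mid y+x\mid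 z$; $\underline a\mid\underline b=\underline c$ if $\gamma(a,b)=c$; $\nu(\underline a)=\underline a$; $\nu(x+y)=\nu(x)+\nu(y)$; $\nu(x\cdot y)=\nu(x)\cdot y$; $\nu(\sigma(x))=\underline\delta$; $\underline a\cdot\underline\tau=\underline a$; $\underline a\cdot(\underline\tau\cdot(\nu(x)+y)+\nu(x))=\underline a\cdot(\nu(x)+y)$; $\underline a\cdot(\underline\tau\cdot(\nu(x)+y)+y)=\underline a\cdot(\nu(x)+y)$; $\underline a\cdot(\sigma(\underline\tau\cdot x)+\nu(y))=\underline a\cdot(\sigma(x)+\nu(y))$. The set of basic terms is the smallest set $\mathcal B$ of closed terms such that: $\underline a\in\mathcal B$ for $a\in A\cup\{\tau,\delta\}$; $\underline a\cdot t\in\mathcal B$ for $a\in A\cup\{\tau\}$ and $t\in\mathcal B$; $\sigma(t)\in\mathcal B$ for $t\in\mathcal B$; $t+t'\in\mathcal B$ for $t,t'\in\mathcal B$. *)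

theory Defs
  imports Main
begin

text \<open>The set of basic actions is a carrier set \<open>A :: 'a set\<close> (possibly empty); the constructors
  \<open>Tau\<close> and \<open>Delta\<close> make \<open>\<tau>\<close> and \<open>\<delta>\<close> distinct from each other and from all basic actions.\<close>

datatype 'a action = Basic 'a | Tau | Delta

definition actions :: "'a set \<Rightarrow> 'a action set" where
  "actions A = Basic ` A \<union> {Tau, Delta}"

definition communication_function :: "'a set \<Rightarrow> ('a action \<Rightarrow> 'a action \<Rightarrow> 'a action) \<Rightarrow> bool" where
  "communication_function A \<gamma> \<longleftrightarrow>
     (\<forall>a\<in>actions A. \<forall>b\<in>actions A. \<gamma> a b \<in> actions A) \<and>
     (\<forall>a\<in>actions A. \<forall>b\<in>actions A. \<gamma> a b = \<gamma> b a) \<and>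
     (\<forall>a\<in>actions A. \<forall>b\<in>actions A. \<forall>c\<in>actions A. \<gamma> (\<gamma> a b) c = \<gamma> a (\<gamma> b c)) \<and>
     (\<forall>a\<in>actions A. \<gamma> Tau a = Delta \<and> \<gamma> Delta a = Delta)"

datatype 'a trm =
    Var nat
  | Const "'a action"                 (\<open>\<langle>_\<rangle>\<close>)
  | Alt "'a trm" "'a trm"             (infixl \<open>\<oplus>\<close> 65)
  | Seq "'a trm" "'a trm"             (infixl \<open>\<odot>\<close> 80)
  | Par "'a trm" "'a trm"             (infixl \<open>\<parallel>\<close> 70)
  | LeftMerge "'a trm" "'a trm"       (infixl \<open>\<parallel>\<^sub>L\<close> 70)
  | CommMerge "'a trm" "'a trm"       (infixl \<open>\<^bold>|\<close> 70)
  | Delay "'a trm"                    (\<open>\<sigma> _\<close> [90] 90)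
  | Encap "'a set" "'a trm"           (\<open>\<partial>\<^bsub>_\<^esub> _\<close> [0, 90] 90)
  | Hide "'a set" "'a trm"            (\<open>\<tau>\<^bsub>_\<^esub> _\<close> [0, 90] 90)
  | Timeout "'a trm"                  (\<open>\<nu> _\<close> [90] 90)

inductive_set terms :: "'a set \<Rightarrow> 'a trm set" for A :: "'a set" where
  "Var x \<in> terms A"
| "a \<in> actions A \<Longrightarrow> \<langle>a\<rangle> \<in> terms A"
| "s \<in> terms A \<Longrightarrow> t \<in> terms A \<Longrightarrow> s \<oplus> t \<in> terms A"
| "s \<in> terms A \<Longrightarrow> t \<in> terms A \<Longrightarrow> s \<odot> t \<in> terms A"
| "s \<in> terms A \<Longrightarrow> t \<in> terms A \<Longrightarrow> s \<parallel> t \<in> terms A"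
| "s \<in> terms A \<Longrightarrow> t \<in> terms A \<Longrightarrow> s \<parallel>\<^sub>L t \<in> terms A"
| "s \<in> terms A \<Longrightarrow> t \<in> terms A \<Longrightarrow> s \<^bold>| t \<in> terms A"
| "t \<in> terms A \<Longrightarrow> \<sigma> t \<in> terms A"
| "H \<subseteq> A \<Longrightarrow> t \<in> terms A \<Longrightarrow> \<partial>\<^bsub>H\<^esub> t \<in> terms A"
| "I \<subseteq> A \<Longrightarrow> t \<in> terms A \<Longrightarrow> \<tau>\<^bsub>I\<^esub> t \<in> terms A"
| "t \<in> terms A \<Longrightarrow> \<nu> t \<in> terms A"

primrec vars :: "'a trm \<Rightarrow> nat set" where
  "vars (Var x) = {x}"
| "vars \<langle>a\<rangle> = {}"
| "vars (s \<oplus> t) = vars s \<union> vars t"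
| "vars (s \<odot> t) = vars s \<union> vars t"
| "vars (s \<parallel> t) = vars s \<union> vars t"
| "vars (s \<parallel>\<^sub>L t) = vars s \<union> vars t"
| "vars (s \<^bold>| t) = vars s \<union> vars t"
| "vars (\<sigma> t) = vars t"
| "vars (\<partial>\<^bsub>H\<^esub> t) = vars t"
| "vars (\<tau>\<^bsub>I\<^esub> t) = vars t"
| "vars (\<nu> t) = vars t"

definition closed_terms :: "'a set \<Rightarrow> 'a trm set" where
  "closed_terms A = {t \<in> terms A. vars t = {}}"

primrec subst :: "(nat \<Rightarrow> 'a trm) \<Rightarrow> 'a trm \<Rightarrow> 'a trm" where
  "subst \<theta> (Var x) = \<theta> x"
| "subst \<theta> \<langle>a\<rangle> = \<langle>a\<rangle>"
| "subst \<theta> (s \<oplus> t) = subst \<theta> s \<oplus> subst \<theta> t"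
| "subst \<theta> (s \<odot> t) = subst \<theta> s \<odot> subst \<theta> t"
| "subst \<theta> (s \<parallel> t) = subst \<theta> s \<parallel> subst \<theta> t"
| "subst \<theta> (s \<parallel>\<^sub>L t) = subst \<theta> s \<parallel>\<^sub>L subst \<theta> t"
| "subst \<theta> (s \<^bold>| t) = subst \<theta> s \<^bold>| subst \<theta> t"
| "subst \<theta> (\<sigma> t) = \<sigma> (subst \<theta> t)"
| "subst \<theta> (\<partial>\<^bsub>H\<^esub> t) = \<partial>\<^bsub>H\<^esub> (subst \<theta> t)"
| "subst \<theta> (\<tau>\<^bsub>I\<^esub> t) = \<tau>\<^bsub>I\<^esub> (subst \<theta> t)"
| "subst \<theta> (\<nu> t) = \<nu> (subst \<theta> t)"

abbreviation var_x :: "'a trm" (\<open>\<^bold>x\<close>) where "\<^bold>x \<equiv> Var 0"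
abbreviation var_y :: "'a trm" (\<open>\<^bold>y\<close>) where "\<^bold>y \<equiv> Var (Suc 0)"
abbreviation var_z :: "'a trm" (\<open>\<^bold>z\<close>) where "\<^bold>z \<equiv> Var (Suc (Suc 0))"

inductive acp_axiom :: "'a set \<Rightarrow> ('a action \<Rightarrow> 'a action \<Rightarrow> 'a action) \<Rightarrow> 'a trm \<Rightarrow> 'a trm \<Rightarrow> bool"
  for A :: "'a set" and \<gamma> :: "'a action \<Rightarrow> 'a action \<Rightarrow> 'a action" where
  "acp_axiom A \<gamma> (\<^bold>x \<oplus> \<^bold>y) (\<^bold>y \<oplus> \<^bold>x)"
| "acp_axiom A \<gamma> ((\<^bold>x \<oplus> \<^bold>y) \<oplus> \<^bold>z) (\<^bold>x \<oplus> (\<^bold>y \<oplus> \<^bold>z))"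
| "acp_axiom A \<gamma> (\<^bold>x \<oplus> \<^bold>x) \<^bold>x"
| "acp_axiom A \<gamma> ((\<^bold>x \<oplus> \<^bold>y) \<odot> \<^bold>z) (\<^bold>x \<odot> \<^bold>z \<oplus> \<^bold>y \<odot> \<^bold>z)"
| "acp_axiom A \<gamma> ((\<^bold>x \<odot> \<^bold>y) \<odot> \<^bold>z) (\<^bold>x \<odot> (\<^bold>y \<odot> \<^bold>z))"
| "acp_axiom A \<gamma> (\<^bold>x \<oplus> \<langle>Delta\<rangle>) \<^bold>x"
| "acp_axiom A \<gamma> (\<langle>Delta\<rangle> \<odot> \<^bold>x) \<langle>Delta\<rangle>"

| "acp_axiom A \<gamma> (\<sigma> \<^bold>x \<oplus> \<sigma> \<^bold>y) (\<sigma> (\<^bold>x \<oplus> \<^bold>y))"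
| "acp_axiom A \<gamma> (\<sigma> \<^bold>x \<odot> \<^bold>y) (\<sigma> (\<^bold>x \<odot> \<^bold>y))"

| "\<lbrakk>a \<in> actions A; H \<subseteq> A; a \<notin> Basic ` H\<rbrakk> \<Longrightarrow> acp_axiom A \<gamma> (\<partial>\<^bsub>H\<^esub> \<langle>a\<rangle>) \<langle>a\<rangle>"
| "\<lbrakk>a \<in> actions A; H \<subseteq> A; a \<in> Basic ` H\<rbrakk> \<Longrightarrow> acp_axiom A \<gamma> (\<partial>\<^bsub>H\<^esub> \<langle>a\<rangle>) \<langle>Delta\<rangle>"
| "H \<subseteq> A \<Longrightarrow> acp_axiom A \<gamma> (\<partial>\<^bsub>H\<^esub> (\<^bold>x \<oplus> \<^bold>y)) (\<partial>\<^bsub>H\<^esub> \<^bold>x \<oplus> \<partial>\<^bsub>H\<^esub> \<^bold>y)"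
| "H \<subseteq> A \<Longrightarrow> acp_axiom A \<gamma> (\<partial>\<^bsub>H\<^esub> (\<^bold>x \<odot> \<^bold>y)) (\<partial>\<^bsub>H\<^esub> \<^bold>x \<odot> \<partial>\<^bsub>H\<^esub> \<^bold>y)"
| "H \<subseteq> A \<Longrightarrow> acp_axiom A \<gamma> (\<partial>\<^bsub>H\<^esub> (\<sigma> \<^bold>x)) (\<sigma> (\<partial>\<^bsub>H\<^esub> \<^bold>x))"

| "\<lbrakk>a \<in> actions A; I \<subseteq> A; a \<notin> Basic ` I\<rbrakk> \<Longrightarrow> acp_axiom A \<gamma> (\<tau>\<^bsub>I\<^esub> \<langle>a\<rangle>) \<langle>a\<rangle>"
| "\<lbrakk>a \<in> actions A; I \<subseteq> A; a \<in> Basic ` I\<rbrakk> \<Longrightarrow> acp_axiom A \<gamma> (\<tau>\<^bsub>I\<^esub> \<langle>a\<rangle>) \<langle>Tau\<rangle>"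
| "I \<subseteq> A \<Longrightarrow> acp_axiom A \<gamma> (\<tau>\<^bsub>I\<^esub> (\<^bold>x \<oplus> \<^bold>y)) (\<tau>\<^bsub>I\<^esub> \<^bold>x \<oplus> \<tau>\<^bsub>I\<^esub> \<^bold>y)"
| "I \<subseteq> A \<Longrightarrow> acp_axiom A \<gamma> (\<tau>\<^bsub>I\<^esub> (\<^bold>x \<odot> \<^bold>y)) (\<tau>\<^bsub>I\<^esub> \<^bold>x \<odot> \<tau>\<^bsub>I\<^esub> \<^bold>y)"
| "I \<subseteq> A \<Longrightarrow> acp_axiom A \<gamma> (\<tau>\<^bsub>I\<^esub> (\<sigma> \<^bold>x)) (\<sigma> (\<tau>\<^bsub>I\<^esub> \<^bold>x))"

| "acp_axiom A \<gamma> (\<^bold>x \<parallel> \<^bold>y) ((\<^bold>x \<parallel>\<^sub>L \<^bold>y \<oplus> \<^bold>y \<parallel>\<^sub>L \<^bold>x) \<oplus> \<^bold>x \<^bold>| \<^bold>y)"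
| "a \<in> actions A \<Longrightarrow> acp_axiom A \<gamma> (\<langle>a\<rangle> \<parallel>\<^sub>L \<^bold>x) (\<langle>a\<rangle> \<odot> \<^bold>x)"
| "a \<in> actions A \<Longrightarrow> acp_axiom A \<gamma> ((\<langle>a\<rangle> \<odot> \<^bold>x) \<parallel>\<^sub>L \<^bold>y) (\<langle>a\<rangle> \<odot> (\<^bold>x \<parallel> \<^bold>y))"
| "acp_axiom A \<gamma> (\<sigma> \<^bold>x \<parallel>\<^sub>L \<nu> \<^bold>y) \<langle>Delta\<rangle>"
| "acp_axiom A \<gamma> (\<sigma> \<^bold>x \<parallel>\<^sub>L (\<nu> \<^bold>y \<oplus> \<sigma> \<^bold>z)) (\<sigma> (\<^bold>x \<parallel>\<^sub>L \<^bold>z))"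
| "acp_axiom A \<gamma> ((\<^bold>x \<oplus> \<^bold>y) \<parallel>\<^sub>L \<^bold>z) (\<^bold>x \<parallel>\<^sub>L \<^bold>z \<oplus> \<^bold>y \<parallel>\<^sub>L \<^bold>z)"
| "\<lbrakk>a \<in> actions A; b \<in> actions A\<rbrakk> \<Longrightarrow>
     acp_axiom A \<gamma> ((\<langle>a\<rangle> \<odot> \<^bold>x) \<^bold>| \<langle>b\<rangle>) ((\<langle>a\<rangle> \<^bold>| \<langle>b\<rangle>) \<odot> \<^bold>x)"
| "\<lbrakk>a \<in> actions A; b \<in> actions A\<rbrakk> \<Longrightarrow>
     acp_axiom A \<gamma> (\<langle>a\<rangle> \<^bold>| (\<langle>b\<rangle> \<odot> \<^bold>x)) ((\<langle>a\<rangle> \<^bold>| \<langle>b\<rangle>) \<odot> \<^bold>x)"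
| "\<lbrakk>a \<in> actions A; b \<in> actions A\<rbrakk> \<Longrightarrow>
     acp_axiom A \<gamma> ((\<langle>a\<rangle> \<odot> \<^bold>x) \<^bold>| (\<langle>b\<rangle> \<odot> \<^bold>y)) ((\<langle>a\<rangle> \<^bold>| \<langle>b\<rangle>) \<odot> (\<^bold>x \<parallel> \<^bold>y))"
| "acp_axiom A \<gamma> (\<nu> \<^bold>x \<^bold>| \<sigma> \<^bold>y) \<langle>Delta\<rangle>"
| "acp_axiom A \<gamma> (\<sigma> \<^bold>x \<^bold>| \<nu> \<^bold>y) \<langle>Delta\<rangle>"
| "acp_axiom A \<gamma> (\<sigma> \<^bold>x \<^bold>| \<sigma> \<^bold>y) (\<sigma> (\<^bold>x \<^bold>| \<^bold>y))"
| "acp_axiom A \<gamma> ((\<^bold>x \<oplus> \<^bold>y) \<^bold>| \<^bold>z) (\<^bold>x \<^bold>| \<^bold>z \<oplus> \<^bold>y \<^bold>| \<^bold>z)"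
| "acp_axiom A \<gamma> (\<^bold>x \<^bold>| (\<^bold>y \<oplus> \<^bold>z)) (\<^bold>x \<^bold>| \<^bold>y \<oplus> \<^bold>x \<^bold>| \<^bold>z)"
| "\<lbrakk>a \<in> actions A; b \<in> actions A; c \<in> actions A; \<gamma> a b = c\<rbrakk> \<Longrightarrow>
     acp_axiom A \<gamma> (\<langle>a\<rangle> \<^bold>| \<langle>b\<rangle>) \<langle>c\<rangle>"

| "a \<in> actions A \<Longrightarrow> acp_axiom A \<gamma> (\<nu> \<langle>a\<rangle>) \<langle>a\<rangle>"
| "acp_axiom A \<gamma> (\<nu> (\<^bold>x \<oplus> \<^bold>y)) (\<nu> \<^bold>x \<oplus> \<nu> \<^bold>y)"
| "acp_axiom A \<gamma> (\<nu> (\<^bold>x \<odot> \<^bold>y)) (\<nu> \<^bold>x \<odot> \<^bold>y)"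
| "acp_axiom A \<gamma> (\<nu> (\<sigma> \<^bold>x)) \<langle>Delta\<rangle>"

| "a \<in> actions A \<Longrightarrow> acp_axiom A \<gamma> (\<langle>a\<rangle> \<odot> \<langle>Tau\<rangle>) \<langle>a\<rangle>"
| "a \<in> actions A \<Longrightarrow>
     acp_axiom A \<gamma> (\<langle>a\<rangle> \<odot> (\<langle>Tau\<rangle> \<odot> (\<nu> \<^bold>x \<oplus> \<^bold>y) \<oplus> \<nu> \<^bold>x)) (\<langle>a\<rangle> \<odot> (\<nu> \<^bold>x \<oplus> \<^bold>y))"
| "a \<in> actions A \<Longrightarrow>
     acp_axiom A \<gamma> (\<langle>a\<rangle> \<odot> (\<langle>Tau\<rangle> \<odot> (\<nu> \<^bold>x \<oplus> \<^bold>y) \<oplus> \<^bold>y)) (\<langle>a\<rangle> \<odot> (\<nu> \<^bold>x \<oplus> \<^bold>y))"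
| "a \<in> actions A \<Longrightarrow>
     acp_axiom A \<gamma> (\<langle>a\<rangle> \<odot> (\<sigma> (\<langle>Tau\<rangle> \<odot> \<^bold>x) \<oplus> \<nu> \<^bold>y)) (\<langle>a\<rangle> \<odot> (\<sigma> \<^bold>x \<oplus> \<nu> \<^bold>y))"

inductive derivable :: "'a set \<Rightarrow> ('a action \<Rightarrow> 'a action \<Rightarrow> 'a action) \<Rightarrow> 'a trm \<Rightarrow> 'a trm \<Rightarrow> bool"
  for A :: "'a set" and \<gamma> :: "'a action \<Rightarrow> 'a action \<Rightarrow> 'a action" where
  ax: "acp_axiom A \<gamma> s t \<Longrightarrow> derivable A \<gamma> s t"
| refl: "t \<in> terms A \<Longrightarrow> derivable A \<gamma> t t"
| sym: "derivable A \<gamma> s t \<Longrightarrow> derivable A \<gamma> t s"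
| trans: "derivable A \<gamma> s t \<Longrightarrow> derivable A \<gamma> t u \<Longrightarrow> derivable A \<gamma> s u"
| inst: "derivable A \<gamma> s t \<Longrightarrow> (\<And>x. \<theta> x \<in> terms A) \<Longrightarrow> derivable A \<gamma> (subst \<theta> s) (subst \<theta> t)"
| cong_Alt: "derivable A \<gamma> s s' \<Longrightarrow> derivable A \<gamma> t t' \<Longrightarrow> derivable A \<gamma> (s \<oplus> t) (s' \<oplus> t')"
| cong_Seq: "derivable A \<gamma> s s' \<Longrightarrow> derivable A \<gamma> t t' \<Longrightarrow> derivable A \<gamma> (s \<odot> t) (s' \<odot> t')"
| cong_Par: "derivable A \<gamma> s s' \<Longrightarrow> derivable A \<gamma> t t' \<Longrightarrow> derivable A \<gamma> (s \<parallel> t) (s' \<parallel> t')"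
| cong_LeftMerge:
    "derivable A \<gamma> s s' \<Longrightarrow> derivable A \<gamma> t t' \<Longrightarrow> derivable A \<gamma> (s \<parallel>\<^sub>L t) (s' \<parallel>\<^sub>L t')"
| cong_CommMerge:
    "derivable A \<gamma> s s' \<Longrightarrow> derivable A \<gamma> t t' \<Longrightarrow> derivable A \<gamma> (s \<^bold>| t) (s' \<^bold>| t')"
| cong_Delay: "derivable A \<gamma> t t' \<Longrightarrow> derivable A \<gamma> (\<sigma> t) (\<sigma> t')"
| cong_Encap: "H \<subseteq> A \<Longrightarrow> derivable A \<gamma> t t' \<Longrightarrow> derivable A \<gamma> (\<partial>\<^bsub>H\<^esub> t) (\<partial>\<^bsub>H\<^esub> t')"
| cong_Hide: "I \<subseteq> A \<Longrightarrow> derivable A \<gamma> t t' \<Longrightarrow> derivable A \<gamma> (\<tau>\<^bsub>I\<^esub> t) (\<tau>\<^bsub>I\<^esub> t')"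
| cong_Timeout: "derivable A \<gamma> t t' \<Longrightarrow> derivable A \<gamma> (\<nu> t) (\<nu> t')"

inductive_set basic_terms :: "'a set \<Rightarrow> 'a trm set" for A :: "'a set" where
  "a \<in> actions A \<Longrightarrow> \<langle>a\<rangle> \<in> basic_terms A"
| "a \<in> Basic ` A \<union> {Tau} \<Longrightarrow> t \<in> basic_terms A \<Longrightarrow> \<langle>a\<rangle> \<odot> t \<in> basic_terms A"
| "t \<in> basic_terms A \<Longrightarrow> \<sigma> t \<in> basic_terms A"
| "t \<in> basic_terms A \<Longrightarrow> t' \<in> basic_terms A \<Longrightarrow> t \<oplus> t' \<in> basic_terms A"

end

theory Submission
  imports Defs
begin

text \<open>Basic terms are closed, up to derivable equality, under every operator. For sequential
  composition, encapsulation, hiding and time-out this is a structural induction. The merges need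
  a simultaneous induction on the sum of the sizes of both arguments. Its critical case is
  \<open>\<sigma> x \<parallel>\<^sub>L y\<close>: there \<open>y\<close> is first brought into the form \<open>\<nu> u\<close> or \<open>\<nu> u \<oplus> \<sigma> v\<close>, by collecting the
  delayed summands, where \<open>v\<close> is smaller than \<open>y\<close>.\<close>

text \<open>Reflexivity and the instantiation of axioms both demand membership in
  \<open>terms A\<close>; this discharges that side condition whenever the arguments are basic
  terms.\<close>

lemma basic_terms_subset_terms: "t \<in> basic_terms A \<Longrightarrow> t \<in> terms A"
  by (induction rule: basic_terms.induct) (auto intro!: terms.intros simp: actions_def)

locale acp =
  fixes A :: "'a set" and \<gamma> :: "'a action \<Rightarrow> 'a action \<Rightarrow> 'a action"
  assumes communication: "communication_function A \<gamma>"
begin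

section \<open>Derivable equality and substitution instances of the axioms\<close>

abbreviation deriv_eq :: "'a trm \<Rightarrow> 'a trm \<Rightarrow> bool" (infix \<open>\<approx>\<close> 50) where
  "s \<approx> t \<equiv> derivable A \<gamma> s t"

lemmas [trans] = derivable.trans

text \<open>The axioms are stated over the variables 0, 1 and 2, and \<open>derivable.inst\<close>
  needs a substitution that is total with values in \<open>terms A\<close>. Here 0 goes to
  \<open>x\<close>, 1 to \<open>y\<close> and every other variable to \<open>z\<close>. For axioms
  with fewer variables the spare slots are filled by repeating an argument.\<close>

lemma axiom_instance:
  assumes "acp_axiom A \<gamma> s t" "x \<in> terms A" "y \<in> terms A" "z \<in> terms A"
  shows "subst (case_nat x (case_nat y (\<lambda>_. z))) s \<approx> subst (case_nat x (case_nat y (\<lambda>_. z))) t"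
  using assms by (intro derivable.inst derivable.ax) (auto split: nat.split)

text \<open>The numbers in \<open>acp_axiom.intros(...)\<close>, here and below, are the positions
  of the axioms in the inductive definition.\<close>

lemma
  assumes "x \<in> terms A" "y \<in> terms A" "z \<in> terms A"
  shows Alt_assoc: "(x \<oplus> y) \<oplus> z \<approx> x \<oplus> (y \<oplus> z)"
    and Alt_Seq: "(x \<oplus> y) \<odot> z \<approx> x \<odot> z \<oplus> y \<odot> z"
    and Seq_assoc: "(x \<odot> y) \<odot> z \<approx> x \<odot> (y \<odot> z)"
    and Delay_LeftMerge_Delay: "\<sigma> x \<parallel>\<^sub>L (\<nu> y \<oplus> \<sigma> z) \<approx> \<sigma> (x \<parallel>\<^sub>L z)"
    and Alt_LeftMerge: "(x \<oplus> y) \<parallel>\<^sub>L z \<approx> x \<parallel>\<^sub>L z \<oplus> y \<parallel>\<^sub>L z"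
    and Alt_CommMerge: "(x \<oplus> y) \<^bold>| z \<approx> x \<^bold>| z \<oplus> y \<^bold>| z"
    and CommMerge_Alt: "x \<^bold>| (y \<oplus> z) \<approx> x \<^bold>| y \<oplus> x \<^bold>| z"
  using acp_axiom.intros(2,4,5,24,25,32,33)[THEN axiom_instance, OF assms] by simp_all

lemma
  assumes "x \<in> terms A" "y \<in> terms A"
  shows Alt_commute: "x \<oplus> y \<approx> y \<oplus> x"
    and Delay_Alt: "\<sigma> x \<oplus> \<sigma> y \<approx> \<sigma> (x \<oplus> y)"
    and Delay_Seq: "\<sigma> x \<odot> y \<approx> \<sigma> (x \<odot> y)"
    and Par_expansion: "x \<parallel> y \<approx> (x \<parallel>\<^sub>L y \<oplus> y \<parallel>\<^sub>L x) \<oplus> x \<^bold>| y"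
    and Delay_LeftMerge_Timeout: "\<sigma> x \<parallel>\<^sub>L \<nu> y \<approx> \<langle>Delta\<rangle>"
    and Timeout_CommMerge_Delay: "\<nu> x \<^bold>| \<sigma> y \<approx> \<langle>Delta\<rangle>"
    and Delay_CommMerge_Timeout: "\<sigma> x \<^bold>| \<nu> y \<approx> \<langle>Delta\<rangle>"
    and Delay_CommMerge_Delay: "\<sigma> x \<^bold>| \<sigma> y \<approx> \<sigma> (x \<^bold>| y)"
    and Timeout_Alt: "\<nu> (x \<oplus> y) \<approx> \<nu> x \<oplus> \<nu> y"
    and Timeout_Seq: "\<nu> (x \<odot> y) \<approx> \<nu> x \<odot> y"
  using acp_axiom.intros(1,8,9,20,23,29,30,31,36,37)[THEN axiom_instance, OF assms assms(2)]
  by simp_all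

lemma
  assumes "x \<in> terms A"
  shows Alt_Delta: "x \<oplus> \<langle>Delta\<rangle> \<approx> x"
    and Delta_Seq: "\<langle>Delta\<rangle> \<odot> x \<approx> \<langle>Delta\<rangle>"
    and Timeout_Delay: "\<nu> (\<sigma> x) \<approx> \<langle>Delta\<rangle>"
  using acp_axiom.intros(6,7,38)[THEN axiom_instance, OF assms assms assms] by simp_all

lemma
  assumes "H \<subseteq> A" "x \<in> terms A" "y \<in> terms A"
  shows Encap_Alt: "\<partial>\<^bsub>H\<^esub> (x \<oplus> y) \<approx> \<partial>\<^bsub>H\<^esub> x \<oplus> \<partial>\<^bsub>H\<^esub> y"
    and Encap_Seq: "\<partial>\<^bsub>H\<^esub> (x \<odot> y) \<approx> \<partial>\<^bsub>H\<^esub> x \<odot> \<partial>\<^bsub>H\<^esub> y"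
    and Encap_Delay: "\<partial>\<^bsub>H\<^esub> (\<sigma> x) \<approx> \<sigma> (\<partial>\<^bsub>H\<^esub> x)"
    and Hide_Alt: "\<tau>\<^bsub>H\<^esub> (x \<oplus> y) \<approx> \<tau>\<^bsub>H\<^esub> x \<oplus> \<tau>\<^bsub>H\<^esub> y"
    and Hide_Seq: "\<tau>\<^bsub>H\<^esub> (x \<odot> y) \<approx> \<tau>\<^bsub>H\<^esub> x \<odot> \<tau>\<^bsub>H\<^esub> y"
    and Hide_Delay: "\<tau>\<^bsub>H\<^esub> (\<sigma> x) \<approx> \<sigma> (\<tau>\<^bsub>H\<^esub> x)"
  using acp_axiom.intros(12-14,17-19)[OF assms(1), THEN axiom_instance, OF assms(2,3,3)]
  by simp_all

lemma
  assumes "a \<in> actions A" "x \<in> terms A" "y \<in> terms A"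
  shows Const_LeftMerge: "\<langle>a\<rangle> \<parallel>\<^sub>L x \<approx> \<langle>a\<rangle> \<odot> x"
    and prefix_LeftMerge: "(\<langle>a\<rangle> \<odot> x) \<parallel>\<^sub>L y \<approx> \<langle>a\<rangle> \<odot> (x \<parallel> y)"
  using acp_axiom.intros(21,22)[OF assms(1), THEN axiom_instance, OF assms(2,3,3)] by simp_all

lemma
  assumes "a \<in> actions A" "b \<in> actions A" "x \<in> terms A" "y \<in> terms A"
  shows prefix_CommMerge_Const: "(\<langle>a\<rangle> \<odot> x) \<^bold>| \<langle>b\<rangle> \<approx> (\<langle>a\<rangle> \<^bold>| \<langle>b\<rangle>) \<odot> x"
    and Const_CommMerge_prefix: "\<langle>a\<rangle> \<^bold>| (\<langle>b\<rangle> \<odot> x) \<approx> (\<langle>a\<rangle> \<^bold>| \<langle>b\<rangle>) \<odot> x"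
    and prefix_CommMerge_prefix:
      "(\<langle>a\<rangle> \<odot> x) \<^bold>| (\<langle>b\<rangle> \<odot> y) \<approx> (\<langle>a\<rangle> \<^bold>| \<langle>b\<rangle>) \<odot> (x \<parallel> y)"
  using acp_axiom.intros(26-28)[OF assms(1,2), THEN axiom_instance, OF assms(3,4,4)]
  by simp_all

lemma Timeout_Const: "a \<in> actions A \<Longrightarrow> \<nu> \<langle>a\<rangle> \<approx> \<langle>a\<rangle>"
  by (intro derivable.ax acp_axiom.intros)

text \<open>The constant is the value of \<gamma>, which lies in \<open>actions A\<close> because
  \<gamma> maps actions to actions; it may well be \<open>Delta\<close>.\<close>

lemma Const_CommMerge_Const:
  assumes "a \<in> actions A" "b \<in> actions A"
  obtains c where "c \<in> actions A" "\<langle>a\<rangle> \<^bold>| \<langle>b\<rangle> \<approx> \<langle>c\<rangle>"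
proof
  show c: "\<gamma> a b \<in> actions A"
    using communication assms by (simp add: communication_function_def)
  show "\<langle>a\<rangle> \<^bold>| \<langle>b\<rangle> \<approx> \<langle>\<gamma> a b\<rangle>"
    using assms c by (auto intro: derivable.ax acp_axiom.intros)
qed

text \<open>The first action takes place in the current time slice, where \<nu> changes nothing.
  Read from right to left, this inserts the \<nu> that several merge axioms require in their
  arguments.\<close>

lemma Timeout_prefix:
  assumes "a \<in> actions A" "x \<in> terms A"
  shows "\<nu> (\<langle>a\<rangle> \<odot> x) \<approx> \<langle>a\<rangle> \<odot> x"
  using assms
  by (meson Timeout_Seq Timeout_Const derivable.trans derivable.cong_Seq derivable.refl
      terms.intros(2))

section \<open>Normalizable terms and the constructors of basic terms\<close>

definition normalizable :: "'a trm \<Rightarrow> bool" where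
  "normalizable t \<longleftrightarrow> (\<exists>t'\<in>basic_terms A. t \<approx> t')"

text \<open>This turns derivable equations into rewrite rules: the goal for the left side of an
  axiom is replaced by the goal for its right side.\<close>

lemma normalizable_trans: "s \<approx> t \<Longrightarrow> normalizable t \<Longrightarrow> normalizable s"
  unfolding normalizable_def by (meson derivable.trans)

lemma normalizable_basic: "t \<in> basic_terms A \<Longrightarrow> normalizable t"
  unfolding normalizable_def by (meson derivable.refl basic_terms_subset_terms)

lemma normalizable_Const: "a \<in> actions A \<Longrightarrow> normalizable \<langle>a\<rangle>"
  by (intro normalizable_basic basic_terms.intros)

lemma normalizable_Delta: "normalizable \<langle>Delta\<rangle>"
  by (intro normalizable_Const) (simp add: actions_def)

lemma normalizable_Alt: "normalizable s \<Longrightarrow> normalizable t \<Longrightarrow> normalizable (s \<oplus> t)"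
  unfolding normalizable_def by (meson derivable.cong_Alt basic_terms.intros(4))

lemma normalizable_Delay: "normalizable t \<Longrightarrow> normalizable (\<sigma> t)"
  unfolding normalizable_def by (meson derivable.cong_Delay basic_terms.intros(3))

lemma normalizable_prefix:
  assumes "a \<in> actions A" "normalizable t"
  shows "normalizable (\<langle>a\<rangle> \<odot> t)"
proof -
  obtain t' where t': "t' \<in> basic_terms A" "t \<approx> t'"
    using assms by (auto simp: normalizable_def)
  have "\<langle>a\<rangle> \<odot> t \<approx> \<langle>a\<rangle> \<odot> t'"
    using assms t' by (auto intro: derivable.intros terms.intros)
  moreover have "normalizable (\<langle>a\<rangle> \<odot> t')"
  \<comment> \<open>Basic terms do not allow \<open>Delta\<close> as a prefix, so that case must
    collapse to \<open>\<langle>Delta\<rangle>\<close>. Every other action is a legitimate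
    prefix.\<close>
  proof (cases "a = Delta")
    case True
    then show ?thesis
      using Delta_Seq normalizable_trans normalizable_Delta t' basic_terms_subset_terms by blast
  next
    case False
    then show ?thesis
      using assms t' by (intro normalizable_basic basic_terms.intros) (auto simp: actions_def)
  qed
  ultimately show ?thesis
    by (rule normalizable_trans)
qed

section \<open>Sequential composition, encapsulation, hiding and time-out of basic terms\<close>

lemma normalizable_Seq_basic:
  assumes "s \<in> basic_terms A" "t \<in> basic_terms A"
  shows "normalizable (s \<odot> t)"
  \<comment> \<open>Only the first factor is analysed; \<open>t\<close> stays fixed and is pushed
    inwards until it stands behind a constant.\<close>
  using assms(1)
proof (induction rule: basic_terms.induct)
  case (1 a)
  then show ?case
    using assms(2) by (intro normalizable_prefix normalizable_basic)
next
  case (2 a s)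
  then have "(\<langle>a\<rangle> \<odot> s) \<odot> t \<approx> \<langle>a\<rangle> \<odot> (s \<odot> t)"
    using assms(2) by (auto intro!: Seq_assoc basic_terms_subset_terms terms.intros simp: actions_def)
  then show ?case
    using 2 by (elim normalizable_trans) (auto intro!: normalizable_prefix simp: actions_def)
next
  case (3 s)
  then have "\<sigma> s \<odot> t \<approx> \<sigma> (s \<odot> t)"
    using assms(2) by (intro Delay_Seq basic_terms_subset_terms)
  then show ?case
    using 3 by (elim normalizable_trans) (intro normalizable_Delay)
next
  case (4 s s')
  then have "(s \<oplus> s') \<odot> t \<approx> s \<odot> t \<oplus> s' \<odot> t"
    using assms(2) by (intro Alt_Seq basic_terms_subset_terms)
  then show ?case
    using 4 by (elim normalizable_trans) (intro normalizable_Alt)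
qed

lemma normalizable_Seq: "normalizable s \<Longrightarrow> normalizable t \<Longrightarrow> normalizable (s \<odot> t)"
  by (meson normalizable_def normalizable_trans normalizable_Seq_basic derivable.cong_Seq)

lemma normalizable_Encap_basic:
  assumes "t \<in> basic_terms A" "H \<subseteq> A"
  shows "normalizable (\<partial>\<^bsub>H\<^esub> t)"
proof -
  have Const: "normalizable (\<partial>\<^bsub>H\<^esub> \<langle>a\<rangle>)" if "a \<in> actions A" for a
  proof (cases "a \<in> Basic ` H")
    case True
    then show ?thesis
      using that assms normalizable_trans normalizable_Delta derivable.ax acp_axiom.intros(11)
      by metis
  next
    case False
    then show ?thesis
      using that assms normalizable_trans normalizable_Const derivable.ax acp_axiom.intros(10)
      by metis
  qed
  show ?thesis
    using assms(1)
  proof (induction rule: basic_terms.induct)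
    case (1 a)
    then show ?case
      by (rule Const)
  next
    case (2 a t)
    then have "a \<in> actions A"
      by (auto simp: actions_def)
    \<comment> \<open>Encapsulation may turn the prefix itself into \<open>Delta\<close>, so the
      result is treated as a product of two normalizable terms and not as a prefix.\<close>
    with 2 show ?case
      by (meson normalizable_trans[OF Encap_Seq[OF assms(2)]] normalizable_Seq Const
          basic_terms_subset_terms terms.intros(2))
  next
    case (3 t)
    then show ?case
      by (meson normalizable_trans[OF Encap_Delay[OF assms(2)]] normalizable_Delay
          basic_terms_subset_terms)
  next
    case (4 t t')
    then show ?case
      by (meson normalizable_trans[OF Encap_Alt[OF assms(2)]] normalizable_Alt
          basic_terms_subset_terms)
  qed
qed

lemma normalizable_Hide_basic:
  assumes "t \<in> basic_terms A" "I \<subseteq> A"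
  shows "normalizable (\<tau>\<^bsub>I\<^esub> t)"
proof -
  have Const: "normalizable (\<tau>\<^bsub>I\<^esub> \<langle>a\<rangle>)" if "a \<in> actions A" for a
  proof (cases "a \<in> Basic ` I")
    case True
    moreover have "normalizable \<langle>Tau\<rangle>"
      by (intro normalizable_Const) (simp add: actions_def)
    ultimately show ?thesis
      using that assms normalizable_trans derivable.ax acp_axiom.intros(16) by metis
  next
    case False
    then show ?thesis
      using that assms normalizable_trans normalizable_Const derivable.ax acp_axiom.intros(15)
      by metis
  qed
  show ?thesis
    using assms(1)
  proof (induction rule: basic_terms.induct)
    case (1 a)
    then show ?case
      by (rule Const)
  next
    case (2 a t)
    then have "a \<in> actions A"
      by (auto simp: actions_def)
    with 2 show ?case
      by (meson normalizable_trans[OF Hide_Seq[OF assms(2)]] normalizable_Seq Const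
          basic_terms_subset_terms terms.intros(2))
  next
    case (3 t)
    then show ?case
      by (meson normalizable_trans[OF Hide_Delay[OF assms(2)]] normalizable_Delay
          basic_terms_subset_terms)
  next
    case (4 t t')
    then show ?case
      by (meson normalizable_trans[OF Hide_Alt[OF assms(2)]] normalizable_Alt
          basic_terms_subset_terms)
  qed
qed

lemma normalizable_Timeout_basic:
  assumes "t \<in> basic_terms A"
  shows "normalizable (\<nu> t)"
  using assms
proof (induction rule: basic_terms.induct)
  case (1 a)
  then show ?case
    by (meson Timeout_Const normalizable_trans normalizable_Const)
next
  case (2 a t)
  then have "a \<in> actions A"
    by (auto simp: actions_def)
  with 2 show ?case
    by (meson Timeout_prefix normalizable_trans normalizable_prefix normalizable_basic
        basic_terms_subset_terms)
next
  case (3 t)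
  then show ?case
    by (meson Timeout_Delay normalizable_trans normalizable_Delta basic_terms_subset_terms)
next
  case (4 t t')
  then show ?case
    by (meson Timeout_Alt normalizable_trans normalizable_Alt basic_terms_subset_terms)
qed

section \<open>Splitting a basic term into its current time slice and its delayed part\<close>

lemma Alt_interchange:
  assumes "p \<in> terms A" "q \<in> terms A" "r \<in> terms A" "s \<in> terms A"
  shows "(p \<oplus> q) \<oplus> (r \<oplus> s) \<approx> (p \<oplus> r) \<oplus> (q \<oplus> s)"
proof -
  note [intro] = assms terms.intros derivable.refl
  have "(p \<oplus> q) \<oplus> (r \<oplus> s) \<approx> p \<oplus> (q \<oplus> (r \<oplus> s))"
    by (rule Alt_assoc) auto
  also have "p \<oplus> (q \<oplus> (r \<oplus> s)) \<approx> p \<oplus> ((q \<oplus> r) \<oplus> s)"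
    by (intro derivable.cong_Alt derivable.sym[OF Alt_assoc]) auto
  also have "p \<oplus> ((q \<oplus> r) \<oplus> s) \<approx> p \<oplus> ((r \<oplus> q) \<oplus> s)"
    by (intro derivable.cong_Alt Alt_commute) auto
  also have "p \<oplus> ((r \<oplus> q) \<oplus> s) \<approx> p \<oplus> (r \<oplus> (q \<oplus> s))"
    by (intro derivable.cong_Alt Alt_assoc) auto
  also have "p \<oplus> (r \<oplus> (q \<oplus> s)) \<approx> (p \<oplus> r) \<oplus> (q \<oplus> s)"
    by (rule derivable.sym[OF Alt_assoc]) auto
  finally show ?thesis .
qed

text \<open>The two forms are exactly the right arguments for which the axioms evaluate a left merge
  with a delayed left argument. In both results \<open>u\<close> disappears, while \<open>v\<close>
  survives and must be smaller than \<open>t\<close> for the later induction; hence the size bound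
  concerns \<open>v\<close> alone.\<close>

lemma Timeout_Delay_decomposition:
  assumes "t \<in> basic_terms A"
  shows "\<exists>u\<in>basic_terms A. t \<approx> \<nu> u \<or>
    (\<exists>v\<in>basic_terms A. size v < size t \<and> t \<approx> \<nu> u \<oplus> \<sigma> v)"
  using assms
proof (induction rule: basic_terms.induct)
  case (1 a)
  then show ?case
    by (meson Timeout_Const derivable.sym basic_terms.intros(1))
next
  case (2 a t)
  then have "\<langle>a\<rangle> \<odot> t \<approx> \<nu> (\<langle>a\<rangle> \<odot> t)"
    by (intro derivable.sym[OF Timeout_prefix]) (auto simp: actions_def basic_terms_subset_terms)
  with 2 show ?case
    by (meson basic_terms.intros(2))
next
  case (3 t)
  have Delta: "Delta \<in> actions A"
    by (simp add: actions_def)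
  have t: "\<sigma> t \<in> terms A"
    using 3 by (intro basic_terms_subset_terms basic_terms.intros)
  \<comment> \<open>A purely delayed term does nothing in the current slice. The missing summand is
    supplied by \<open>\<langle>Delta\<rangle>\<close>, which equals its own time-out.\<close>
  have "\<sigma> t \<approx> \<sigma> t \<oplus> \<langle>Delta\<rangle>"
    using t by (intro derivable.sym[OF Alt_Delta])
  also have "\<dots> \<approx> \<langle>Delta\<rangle> \<oplus> \<sigma> t"
    using t Delta by (intro Alt_commute terms.intros(2))
  also have "\<dots> \<approx> \<nu> \<langle>Delta\<rangle> \<oplus> \<sigma> t"
    using t Delta by (intro derivable.cong_Alt derivable.sym[OF Timeout_Const] derivable.refl)
  finally have "\<sigma> t \<approx> \<nu> \<langle>Delta\<rangle> \<oplus> \<sigma> t" .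
  then show ?case
    using 3 Delta by (intro bexI[of _ "\<langle>Delta\<rangle>"] disjI2 bexI[of _ t]) (auto intro: basic_terms.intros)
next
  case (4 s t)
  obtain u where u: "u \<in> basic_terms A"
    and s: "s \<approx> \<nu> u \<or> (\<exists>v\<in>basic_terms A. size v < size s \<and> s \<approx> \<nu> u \<oplus> \<sigma> v)"
    using 4 by blast
  obtain u' where u': "u' \<in> basic_terms A"
    and t: "t \<approx> \<nu> u' \<or> (\<exists>v\<in>basic_terms A. size v < size t \<and> t \<approx> \<nu> u' \<oplus> \<sigma> v)"
    using 4 by blast
  have uu': "u \<oplus> u' \<in> basic_terms A"
    using u u' by (rule basic_terms.intros)
  have timeout: "\<nu> u \<oplus> \<nu> u' \<approx> \<nu> (u \<oplus> u')"
    using u u' by (intro derivable.sym[OF Timeout_Alt] basic_terms_subset_terms)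
  have un: "\<nu> u \<in> terms A" "\<nu> u' \<in> terms A"
    using u u' by (auto intro: terms.intros basic_terms_subset_terms)
  from s t show ?case
  proof (elim disjE bexE conjE)
    assume "s \<approx> \<nu> u" "t \<approx> \<nu> u'"
    then have "s \<oplus> t \<approx> \<nu> (u \<oplus> u')"
      by (meson derivable.cong_Alt derivable.trans timeout)
    with uu' show ?thesis by blast
  next
    fix v
    assume v: "v \<in> basic_terms A" "size v < size t" and st: "s \<approx> \<nu> u" "t \<approx> \<nu> u' \<oplus> \<sigma> v"
    then have vt: "\<sigma> v \<in> terms A"
      by (auto intro: terms.intros basic_terms_subset_terms)
    have "s \<oplus> t \<approx> \<nu> u \<oplus> (\<nu> u' \<oplus> \<sigma> v)"
      using st by (rule derivable.cong_Alt)
    also have "\<dots> \<approx> (\<nu> u \<oplus> \<nu> u') \<oplus> \<sigma> v"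
      using un vt by (intro derivable.sym[OF Alt_assoc])
    also have "\<dots> \<approx> \<nu> (u \<oplus> u') \<oplus> \<sigma> v"
      using vt by (intro derivable.cong_Alt timeout derivable.refl)
    finally show ?thesis
      using v uu' by (intro bexI[of _ "u \<oplus> u'"] disjI2 bexI[of _ v]) auto
  next
    fix v
    assume v: "v \<in> basic_terms A" "size v < size s" and st: "s \<approx> \<nu> u \<oplus> \<sigma> v" "t \<approx> \<nu> u'"
    then have vt: "\<sigma> v \<in> terms A"
      by (auto intro: terms.intros basic_terms_subset_terms)
    have "s \<oplus> t \<approx> (\<nu> u \<oplus> \<sigma> v) \<oplus> \<nu> u'"
      using st by (rule derivable.cong_Alt)
    also have "\<dots> \<approx> \<nu> u \<oplus> (\<sigma> v \<oplus> \<nu> u')"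
      using un vt by (intro Alt_assoc)
    also have "\<dots> \<approx> \<nu> u \<oplus> (\<nu> u' \<oplus> \<sigma> v)"
      using un vt by (intro derivable.cong_Alt Alt_commute derivable.refl)
    also have "\<dots> \<approx> (\<nu> u \<oplus> \<nu> u') \<oplus> \<sigma> v"
      using un vt by (intro derivable.sym[OF Alt_assoc])
    also have "\<dots> \<approx> \<nu> (u \<oplus> u') \<oplus> \<sigma> v"
      using vt by (intro derivable.cong_Alt timeout derivable.refl)
    finally show ?thesis
      using v uu' by (intro bexI[of _ "u \<oplus> u'"] disjI2 bexI[of _ v]) auto
  next
    fix v v'
    assume v: "v \<in> basic_terms A" "size v < size s" "v' \<in> basic_terms A" "size v' < size t"
      and st: "s \<approx> \<nu> u \<oplus> \<sigma> v" "t \<approx> \<nu> u' \<oplus> \<sigma> v'"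
    then have vt: "v \<in> terms A" "v' \<in> terms A"
      by (auto intro: basic_terms_subset_terms)
    have "s \<oplus> t \<approx> (\<nu> u \<oplus> \<sigma> v) \<oplus> (\<nu> u' \<oplus> \<sigma> v')"
      using st by (rule derivable.cong_Alt)
    also have "\<dots> \<approx> (\<nu> u \<oplus> \<nu> u') \<oplus> (\<sigma> v \<oplus> \<sigma> v')"
      using un vt by (intro Alt_interchange terms.intros(8))
    \<comment> \<open>The two delayed parts merge into a single one. The witness
      \<open>v \<oplus> v'\<close> is still smaller than \<open>s \<oplus> t\<close>, since each sum
      adds the same amount to the sizes of its summands.\<close>
    also have "\<dots> \<approx> \<nu> (u \<oplus> u') \<oplus> \<sigma> (v \<oplus> v')"
      using vt by (intro derivable.cong_Alt timeout Delay_Alt)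
    finally show ?thesis
      using v uu'
      by (intro bexI[of _ "u \<oplus> u'"] disjI2 bexI[of _ "v \<oplus> v'"]) (auto intro: basic_terms.intros)
  qed
qed

section \<open>The merges of basic terms\<close>

lemma normalizable_Par_if:
  assumes "s \<in> basic_terms A" "t \<in> basic_terms A"
    and "normalizable (s \<parallel>\<^sub>L t)" "normalizable (t \<parallel>\<^sub>L s)" "normalizable (s \<^bold>| t)"
  shows "normalizable (s \<parallel> t)"
  using assms
  by (intro normalizable_trans[OF Par_expansion] normalizable_Alt basic_terms_subset_terms)

text \<open>An action of the current slice cannot communicate with a delayed term, so all four terms
  equal \<open>\<langle>Delta\<rangle>\<close>.\<close>

lemma normalizable_CommMerge_Delay:
  assumes "a \<in> actions A" "x \<in> terms A" "y \<in> terms A"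
  shows "normalizable (\<langle>a\<rangle> \<^bold>| \<sigma> y)" "normalizable ((\<langle>a\<rangle> \<odot> x) \<^bold>| \<sigma> y)"
    "normalizable (\<sigma> y \<^bold>| \<langle>a\<rangle>)" "normalizable (\<sigma> y \<^bold>| (\<langle>a\<rangle> \<odot> x))"
proof -
  have terms: "\<langle>a\<rangle> \<in> terms A" "\<langle>a\<rangle> \<odot> x \<in> terms A" "\<sigma> y \<in> terms A"
    using assms by (auto intro: terms.intros)
  \<comment> \<open>Constants and prefixes share the property of being equal to their own time-out,
    and this is all that the two axioms with \<nu> on one side and \<sigma> on the other
    need.\<close>
  have "normalizable (z \<^bold>| \<sigma> y) \<and> normalizable (\<sigma> y \<^bold>| z)" if "\<nu> z \<approx> z" "z \<in> terms A" for z
  proof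
    have "z \<^bold>| \<sigma> y \<approx> \<nu> z \<^bold>| \<sigma> y"
      using that terms by (intro derivable.cong_CommMerge derivable.sym[OF that(1)] derivable.refl)
    also have "\<dots> \<approx> \<langle>Delta\<rangle>"
      using that assms by (intro Timeout_CommMerge_Delay)
    finally show "normalizable (z \<^bold>| \<sigma> y)"
      using normalizable_Delta by (rule normalizable_trans)
    have "\<sigma> y \<^bold>| z \<approx> \<sigma> y \<^bold>| \<nu> z"
      using that terms by (intro derivable.cong_CommMerge derivable.sym[OF that(1)] derivable.refl)
    also have "\<dots> \<approx> \<langle>Delta\<rangle>"
      using that assms by (intro Delay_CommMerge_Timeout)
    finally show "normalizable (\<sigma> y \<^bold>| z)"
      using normalizable_Delta by (rule normalizable_trans)
  qed
  then show "normalizable (\<langle>a\<rangle> \<^bold>| \<sigma> y)" "normalizable ((\<langle>a\<rangle> \<odot> x) \<^bold>| \<sigma> y)"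
    "normalizable (\<sigma> y \<^bold>| \<langle>a\<rangle>)" "normalizable (\<sigma> y \<^bold>| (\<langle>a\<rangle> \<odot> x))"
    using terms assms Timeout_Const Timeout_prefix by blast+
qed

lemma normalizable_Const_CommMerge_Const_Seq:
  assumes "a \<in> actions A" "b \<in> actions A" "normalizable t"
  shows "normalizable ((\<langle>a\<rangle> \<^bold>| \<langle>b\<rangle>) \<odot> t)"
  using assms
  by (meson Const_CommMerge_Const normalizable_trans normalizable_Const normalizable_Seq)

text \<open>Neither merge can be treated alone: prefixes lead from both of them to a parallel
  composition, which expands into the left merge in both orders and the communication merge.\<close>

lemma normalizable_LeftMerge_CommMerge_basic:
  assumes "s \<in> basic_terms A" "t \<in> basic_terms A"
  shows "normalizable (s \<parallel>\<^sub>L t) \<and> normalizable (s \<^bold>| t)"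
  using assms
proof (induction "size s + size t" arbitrary: s t rule: less_induct)
  case less
  \<comment> \<open>The measure is symmetric, so the induction hypothesis is available for the
    swapped pair too. This yields parallel composition for all smaller pairs.\<close>
  have left: "normalizable (x \<parallel>\<^sub>L y)" and comm: "normalizable (x \<^bold>| y)"
    and par: "normalizable (x \<parallel> y)"
    if "x \<in> basic_terms A" "y \<in> basic_terms A" "size x + size y < size s + size t" for x y
    using less.hyps[of x y] less.hyps[of y x] that normalizable_Par_if[of x y]
    by (auto simp: add.commute)
  note terms = basic_terms_subset_terms
  note basic = less.prems
  have "normalizable (s \<parallel>\<^sub>L t)"
    using basic(1)
  proof cases
    case (1 a)
    then show ?thesis
      using basic terms normalizable_basic
      by (auto intro!: normalizable_trans[OF Const_LeftMerge] normalizable_prefix)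
  next
    case (2 a x)
    then have "a \<in> actions A"
      by (auto simp: actions_def)
    with 2 show ?thesis
      using basic terms par[of x t]
      by (auto intro!: normalizable_trans[OF prefix_LeftMerge] normalizable_prefix)
  next
    case (3 x)
    obtain u where u: "u \<in> basic_terms A"
      and t: "t \<approx> \<nu> u \<or> (\<exists>v\<in>basic_terms A. size v < size t \<and> t \<approx> \<nu> u \<oplus> \<sigma> v)"
      using Timeout_Delay_decomposition[OF basic(2)] by blast
    have cong: "\<sigma> x \<parallel>\<^sub>L t \<approx> \<sigma> x \<parallel>\<^sub>L t'" if "t \<approx> t'" for t'
      using 3 that by (intro derivable.cong_LeftMerge derivable.refl terms.intros(8) terms)
    from t show ?thesis
    proof (elim disjE bexE conjE)
      assume "t \<approx> \<nu> u"
      then have "\<sigma> x \<parallel>\<^sub>L t \<approx> \<langle>Delta\<rangle>"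
        using 3 u by (meson cong Delay_LeftMerge_Timeout derivable.trans terms)
      then show ?thesis
        using 3 normalizable_Delta normalizable_trans by blast
    next
      fix v
      \<comment> \<open>The rewritten form of \<open>t\<close> may be larger than \<open>t\<close>,
        but the hypothesis is applied only to the pair \<open>x\<close>, \<open>v\<close>, and both
        are smaller than the original arguments.\<close>
      assume v: "v \<in> basic_terms A" "size v < size t" "t \<approx> \<nu> u \<oplus> \<sigma> v"
      then have "\<sigma> x \<parallel>\<^sub>L t \<approx> \<sigma> (x \<parallel>\<^sub>L v)"
        using 3 u by (meson cong Delay_LeftMerge_Delay derivable.trans terms)
      then show ?thesis
        using 3 v left[of x v] by (auto intro: normalizable_trans normalizable_Delay)
    qed
  next
    case (4 x y)
    then show ?thesis
      using basic terms left[of x t] left[of y t]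
      by (auto intro!: normalizable_trans[OF Alt_LeftMerge] normalizable_Alt)
  qed
  \<comment> \<open>Sums on the right are distributed first. Afterwards \<open>t\<close> is a
    constant, a prefix or a delay, which leaves a three by three table of cases and the sums on the
    left.\<close>
  moreover have "normalizable (s \<^bold>| t)"
  proof (cases "\<exists>y z. t = y \<oplus> z")
    case True
    then obtain y z where t: "t = y \<oplus> z"
      by blast
    then have "y \<in> basic_terms A" "z \<in> basic_terms A"
      using basic(2) by (auto elim: basic_terms.cases)
    then show ?thesis
      using t basic terms comm[of s y] comm[of s z]
      by (auto intro!: normalizable_trans[OF CommMerge_Alt] normalizable_Alt)
  next
    case noAlt: False
    have act: "a \<in> Basic ` A \<union> {Tau} \<Longrightarrow> a \<in> actions A" for a
      by (auto simp: actions_def)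
    from basic(1) show ?thesis
    proof cases
      case s: (1 a)
      from basic(2) show ?thesis
      proof cases
        case (1 b)
        then show ?thesis
          using s by (meson Const_CommMerge_Const normalizable_trans normalizable_Const)
      next
        case (2 b y)
        then show ?thesis
          using s terms act normalizable_basic
          by (auto intro!: normalizable_trans[OF Const_CommMerge_prefix]
              normalizable_Const_CommMerge_Const_Seq)
      next
        case (3 y)
        then show ?thesis
          using s terms by (auto intro: normalizable_CommMerge_Delay)
      qed (use noAlt in blast)
    next
      case s: (2 a x)
      from basic(2) show ?thesis
      proof cases
        case (1 b)
        then show ?thesis
          using s terms act normalizable_basic
          by (auto intro!: normalizable_trans[OF prefix_CommMerge_Const]
              normalizable_Const_CommMerge_Const_Seq)
      next
        case (2 b y)
        then show ?thesis
          using s terms act par[of x y]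
          by (auto intro!: normalizable_trans[OF prefix_CommMerge_prefix]
              normalizable_Const_CommMerge_Const_Seq)
      next
        case (3 y)
        then show ?thesis
          using s terms act by (auto intro!: normalizable_CommMerge_Delay)
      qed (use noAlt in blast)
    next
      case s: (3 x)
      from basic(2) show ?thesis
      proof cases
        case (1 b)
        then show ?thesis
          using s terms by (auto intro: normalizable_CommMerge_Delay)
      next
        case (2 b y)
        then show ?thesis
          using s terms act by (auto intro!: normalizable_CommMerge_Delay)
      next
        case (3 y)
        then show ?thesis
          using s terms comm[of x y]
          by (auto intro!: normalizable_trans[OF Delay_CommMerge_Delay] normalizable_Delay)
      qed (use noAlt in blast)
    next
      case (4 x y)
      then show ?thesis
        using basic terms comm[of x t] comm[of y t]
        by (auto intro!: normalizable_trans[OF Alt_CommMerge] normalizable_Alt)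
    qed
  qed
  ultimately show ?case ..
qed

section \<open>From basic arguments to normalizable arguments, and on to closed terms\<close>

lemma normalizable_LeftMerge:
  "normalizable s \<Longrightarrow> normalizable t \<Longrightarrow> normalizable (s \<parallel>\<^sub>L t)"
  by (meson normalizable_def normalizable_trans normalizable_LeftMerge_CommMerge_basic
      derivable.cong_LeftMerge)

lemma normalizable_CommMerge:
  "normalizable s \<Longrightarrow> normalizable t \<Longrightarrow> normalizable (s \<^bold>| t)"
  by (meson normalizable_def normalizable_trans normalizable_LeftMerge_CommMerge_basic
      derivable.cong_CommMerge)

text \<open>By congruence both arguments are first replaced by basic terms; the expansion then needs
  the result on merges for these basic terms in both orders.\<close>

lemma normalizable_Par: "normalizable s \<Longrightarrow> normalizable t \<Longrightarrow> normalizable (s \<parallel> t)"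
  by (meson normalizable_def normalizable_trans normalizable_LeftMerge_CommMerge_basic
      normalizable_Par_if derivable.cong_Par)

lemma normalizable_Encap: "H \<subseteq> A \<Longrightarrow> normalizable t \<Longrightarrow> normalizable (\<partial>\<^bsub>H\<^esub> t)"
  by (meson normalizable_def normalizable_trans normalizable_Encap_basic derivable.cong_Encap)

lemma normalizable_Hide: "I \<subseteq> A \<Longrightarrow> normalizable t \<Longrightarrow> normalizable (\<tau>\<^bsub>I\<^esub> t)"
  by (meson normalizable_def normalizable_trans normalizable_Hide_basic derivable.cong_Hide)

lemma normalizable_Timeout: "normalizable t \<Longrightarrow> normalizable (\<nu> t)"
  by (meson normalizable_def normalizable_trans normalizable_Timeout_basic derivable.cong_Timeout)

text \<open>Each operator of the signature has its own closure lemma, and closedness rules out the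
  variable case.\<close>

lemma closed_term_normalizable: "t \<in> terms A \<Longrightarrow> vars t = {} \<Longrightarrow> normalizable t"
  by (induction rule: terms.induct)
    (auto intro: normalizable_Const normalizable_Alt normalizable_Seq normalizable_Par
      normalizable_LeftMerge normalizable_CommMerge normalizable_Delay normalizable_Encap
      normalizable_Hide normalizable_Timeout)

end

theorem theorem1:
  fixes A :: "'a set" and \<gamma> :: "'a action \<Rightarrow> 'a action \<Rightarrow> 'a action" and t :: "'a trm"
  assumes "finite A"
    and "communication_function A \<gamma>"
    and "t \<in> closed_terms A"
  shows "\<exists>t'\<in>basic_terms A. derivable A \<gamma> t t'"
proof -
  interpret acp A \<gamma>
    using assms(2) by unfold_locales
  show ?thesis
    using closed_term_normalizable assms(3) by (simp add: closed_terms_def normalizable_def)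
qed

end
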